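(* Suppose $\det(\nu_{i+j,n})_{i,j=0}^{n}\neq0$ for all $n\ge0$. Then for every $n\ge0$, \[ \det(\nu_{i+j,j})_{0\le i,j\le n}=\prod_{k=1}^n\frac{\lambda_k^k}{(-a_k)^kP_k(-\lambda_k/a_k)},\qquad \det(\nu_{i,j})_{0\le i,j\le n}=\prod_{k=1}^n\frac{1}{P_k(-\lambda_k/a_k)}. \]
   Context: Let $\{b_n\}_{n\ge0},\{a_n\}_{n\ge0},\{\lambda_n\}_{n\ge0}$ be sequences of complex numbers. Define monic polynomials $P_n(x)$ by $P_{-1}(x)=0$, $P_0(x)=1$ and $P_{n+1}(x)=(x-b_n)P_n(x)-(a_nx+\lambda_n)P_{n-1}(x)$ for $n\ge0$. Let $d_0(x)=1$, $d_m(x)=\prod_{i=1}^m(a_ix+\lambda_i)$, and $Q_m(x)=P_m(x)/d_m(x)$. Assume $a_n\neq0$ and $P_n(-\lambda_n/a_n)\neq 0$ for all $n\ge1$. Let $V=\mathrm{span}\{x^nQ_m(x):n,m\ge0\}$ (rational functions; it contains every $x^n/d_m(x)$), and let $\mathcal{L}$ be the unique linear functional on $V$ with $\mathcal{L}(1)=1$ and $\mathcal{L}(x^nQ_m(x))=0$ whenever $0\le n<m$. Set $\nu_{n,m}=\mathcal{L}(x^n/d_m(x))$. *)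

theory Defs
  imports
    "HOL-Computational_Algebra.Polynomial"
    "HOL-Computational_Algebra.Fraction_Field"
    "Jordan_Normal_Form.Determinant"
begin

text \<open>The field of rational functions \<open>complex poly fract\<close> as a complex vector space.\<close>

definition ratfun_scale :: "complex \<Rightarrow> complex poly fract \<Rightarrow> complex poly fract" where
  "ratfun_scale c f = Fract [:c:] 1 * f"

interpretation ratfun: vector_space ratfun_scale
proof
  fix c d :: complex and f g :: "complex poly fract"
  show "ratfun_scale c (f + g) = ratfun_scale c f + ratfun_scale c g"
    by (simp add: ratfun_scale_def distrib_left)
  have "Fract [:c + d:] 1 = Fract [:c:] 1 + Fract [:d:] 1"
    by simp
  then show "ratfun_scale (c + d) f = ratfun_scale c f + ratfun_scale d f"
    by (simp only: ratfun_scale_def distrib_right)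
  have "Fract [:c * d:] 1 = Fract [:c:] 1 * Fract [:d:] 1"
    by (simp add: mult.commute)
  then show "ratfun_scale c (ratfun_scale d f) = ratfun_scale (c * d) f"
    by (simp only: ratfun_scale_def mult.assoc)
  show "ratfun_scale 1 f = f"
    by (simp add: ratfun_scale_def pCons_one One_fract_def [symmetric])
qed

text \<open>Below, \<open>l\<close> is the sequence of the \<open>\<lambda>\<^sub>n\<close>. The convention \<open>P\<^sub>-\<^sub>1 = 0\<close> is built into the equation
  for \<open>P\<^sub>1\<close>, so \<open>a 0\<close> and \<open>l 0\<close> do not occur.\<close>

fun RI_P :: "(nat \<Rightarrow> complex) \<Rightarrow> (nat \<Rightarrow> complex) \<Rightarrow> (nat \<Rightarrow> complex) \<Rightarrow> nat \<Rightarrow> complex poly" where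
  "RI_P b a l 0 = 1"
| "RI_P b a l (Suc 0) = [:- b 0, 1:]"
| "RI_P b a l (Suc (Suc n)) =
     [:- b (Suc n), 1:] * RI_P b a l (Suc n) - [:l (Suc n), a (Suc n):] * RI_P b a l n"

definition RI_d :: "(nat \<Rightarrow> complex) \<Rightarrow> (nat \<Rightarrow> complex) \<Rightarrow> nat \<Rightarrow> complex poly" where
  "RI_d a l m = (\<Prod>i = 1..m. [:l i, a i:])"

definition RI_Q ::
  "(nat \<Rightarrow> complex) \<Rightarrow> (nat \<Rightarrow> complex) \<Rightarrow> (nat \<Rightarrow> complex) \<Rightarrow> nat \<Rightarrow> complex poly fract" where
  "RI_Q b a l m = Fract (RI_P b a l m) (RI_d a l m)"

definition RI_V ::
  "(nat \<Rightarrow> complex) \<Rightarrow> (nat \<Rightarrow> complex) \<Rightarrow> (nat \<Rightarrow> complex) \<Rightarrow> complex poly fract set" where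
  "RI_V b a l = ratfun.span {Fract (monom 1 n) 1 * RI_Q b a l m | n m. True}"

text \<open>A functional on the subspace \<open>RI_V b a l\<close> is represented by a function on all rational functions
  whose values outside the subspace are unconstrained.\<close>

definition RI_functional ::
  "(nat \<Rightarrow> complex) \<Rightarrow> (nat \<Rightarrow> complex) \<Rightarrow> (nat \<Rightarrow> complex) \<Rightarrow> (complex poly fract \<Rightarrow> complex) \<Rightarrow> bool"
where
  "RI_functional b a l L \<longleftrightarrow>
     (\<forall>f \<in> RI_V b a l. \<forall>g \<in> RI_V b a l. L (f + g) = L f + L g) \<and>
     (\<forall>c. \<forall>f \<in> RI_V b a l. L (ratfun_scale c f) = c * L f) \<and>
     L 1 = 1 \<and>
     (\<forall>n m. n < m \<longrightarrow> L (Fract (monom 1 n) 1 * RI_Q b a l m) = 0)"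

definition RI_moment ::
  "(nat \<Rightarrow> complex) \<Rightarrow> (nat \<Rightarrow> complex) \<Rightarrow> (complex poly fract \<Rightarrow> complex) \<Rightarrow> nat \<Rightarrow> nat \<Rightarrow> complex" where
  "RI_moment a l L n m = L (Fract (monom 1 n) (RI_d a l m))"

end

theory Submission
  imports Defs
begin

text \<open>Both determinants are instances of \<open>det (L (x\<^sup>i g\<^sup>j / d\<^sub>j))\<close> with a polynomial \<open>g\<close> of degree at most
  one: \<open>g = x\<close> and \<open>g = 1\<close>. Write \<open>r\<^sub>k = - \<lambda>\<^sub>k / a\<^sub>k\<close> and suppose first that no \<open>g(r\<^sub>k)\<close> vanishes. Dividing
  by \<open>a\<^sub>n x + \<lambda>\<^sub>n\<close> gives \<open>g\<^sup>n = c P\<^sub>n + (a\<^sub>n x + \<lambda>\<^sub>n) q\<close> with \<open>c = g(r\<^sub>n)\<^sup>n / P\<^sub>n(r\<^sub>n)\<close> and \<open>deg q < n\<close>, and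
  \<open>q / d\<^sub>n\<^sub>-\<^sub>1\<close> is a linear combination of the \<open>g\<^sup>j / d\<^sub>j\<close> with \<open>j < n\<close>. Modulo the preceding columns, the
  last column is therefore \<open>c L (x\<^sup>i P\<^sub>n / d\<^sub>n)\<close>, which is zero for \<open>i < n\<close> by orthogonality. For \<open>i = n\<close> it
  is \<open>c\<close>, because the recurrence shows that \<open>L (x\<^sup>n Q\<^sub>n)\<close> does not depend on \<open>n\<close>. If some \<open>g(r\<^sub>k) = 0\<close>,
  then the columns \<open>k - 1\<close> and \<open>k\<close> are proportional and both sides vanish.\<close>

section \<open>Determinants with a dependent column\<close>

text \<open>The matrix factors as \<open>B * U\<close>: the unit upper triangular \<open>U\<close>
  carries the coefficients \<open>t\<close>, and the last column of \<open>B\<close> is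
  \<open>c\<close> times a unit vector, along which \<open>det B\<close> is expanded.\<close>

lemma det_last_column_combination:
  fixes A :: "nat \<Rightarrow> nat \<Rightarrow> 'a :: idom"
  assumes col: "\<And>i. i \<le> n \<Longrightarrow> A i n = (if i = n then c else 0) + (\<Sum>j<n. t j * A i j)"
  shows "det (mat (Suc n) (Suc n) (\<lambda>(i, j). A i j)) = c * det (mat n n (\<lambda>(i, j). A i j))"
proof -
  define B where "B = mat (Suc n) (Suc n) (\<lambda>(i, j). if j = n then if i = n then c else 0 else A i j)"
  define U where "U = mat (Suc n) (Suc n) (\<lambda>(i, j). if i = j then 1 else if j = n then t i else 0)"
  have B: "B \<in> carrier_mat (Suc n) (Suc n)" and U: "U \<in> carrier_mat (Suc n) (Suc n)"
    by (auto simp: B_def U_def)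
  have "mat (Suc n) (Suc n) (\<lambda>(i, j). A i j) = B * U"
  proof (rule eq_matI)
    fix i j assume "i < dim_row (B * U)" "j < dim_col (B * U)"
    then have ij: "i < Suc n" "j < Suc n" by (auto simp: B_def U_def)
    have "(B * U) $$ (i, j) = (\<Sum>k<Suc n. B $$ (i, k) * U $$ (k, j))"
      using ij by (simp add: B_def U_def scalar_prod_def lessThan_atLeast0)
    also have "\<dots> = A i j"
    proof (cases "j = n")
      case True
      have "(\<Sum>k<n. B $$ (i, k) * U $$ (k, j)) = (\<Sum>k<n. t k * A i k)"
        using ij True by (intro sum.cong) (auto simp: B_def U_def)
      then show ?thesis using ij True col[of i] by (simp add: B_def U_def)
    next
      case False
      have "(\<Sum>k<Suc n. B $$ (i, k) * U $$ (k, j)) = (\<Sum>k<Suc n. if k = j then A i j else 0)"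
        using ij False by (intro sum.cong) (auto simp: B_def U_def)
      then show ?thesis using ij by simp
    qed
    finally show "mat (Suc n) (Suc n) (\<lambda>(i, j). A i j) $$ (i, j) = (B * U) $$ (i, j)"
      using ij by simp
  qed (auto simp: B_def U_def)
  moreover have "det U = 1"
  proof -
    have "det U = prod_list (diag_mat U)"
      by (rule det_upper_triangular[OF _ U]) (auto simp: U_def)
    also have "diag_mat U = map (\<lambda>i. 1) [0..<Suc n]"
      unfolding diag_mat_def by (rule map_cong) (auto simp: U_def)
    finally show ?thesis by (simp del: upt_Suc add: map_replicate_const)
  qed
  moreover have "det B = c * det (mat n n (\<lambda>(i, j). A i j))"
  proof -
    have "det B = (\<Sum>i<Suc n. B $$ (i, n) * cofactor B i n)"
      by (rule laplace_expansion_column[OF B]) simp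
    also have "\<dots> = c * cofactor B n n" by (simp add: B_def)
    also have "mat_delete B n n = mat n n (\<lambda>(i, j). A i j)"
      by (rule eq_matI) (auto simp: mat_delete_def B_def)
    then have "cofactor B n n = det (mat n n (\<lambda>(i, j). A i j))"
      by (simp add: cofactor_def)
    finally show ?thesis .
  qed
  ultimately show ?thesis by (simp add: det_mult[OF B U])
qed

lemma det_proportional_columns:
  fixes A :: "'a :: field mat"
  assumes A: "A \<in> carrier_mat n n" and jk: "j < n" "k < n" "j \<noteq> k"
    and col: "\<And>i. i < n \<Longrightarrow> A $$ (i, k) = c * A $$ (i, j)"
  shows "det A = 0"
proof -
  have "det A = det (addcol (- c) k j A)"
    by (rule det_addcol[OF jk(1) jk(3)[symmetric] A, symmetric])
  also have "\<dots> = (\<Sum>i<n. addcol (- c) k j A $$ (i, k) * cofactor (addcol (- c) k j A) i k)"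
    by (rule laplace_expansion_column[OF _ jk(2)]) (use A in \<open>simp add: mat_addcol_def\<close>)
  also have "\<dots> = 0"
    using A jk col by (intro sum.neutral) auto
  finally show ?thesis .
qed

section \<open>Division by linear factors and degree bounds\<close>

lemma linear_factor_dvd:
  fixes a l :: "'a :: field"
  assumes "a \<noteq> 0" "poly s (- l / a) = 0" "degree s \<le> Suc m"
  obtains q where "s = [:l, a:] * q" "degree q \<le> m"
proof -
  from assms(2) obtain q where q: "s = [:l / a, 1:] * q"
    by (auto simp: poly_eq_0_iff_dvd elim: dvdE)
  have "s = [:l, a:] * smult (inverse a) q"
    using assms(1) unfolding q by (simp add: smult_add_right divide_inverse mult.commute)
  moreover have "degree (smult (inverse a) q) \<le> m"
  proof (cases "q = 0")
    case False
    then have "degree s = Suc (degree q)"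
      unfolding q by (subst degree_mult_eq) auto
    with assms show ?thesis by simp
  qed simp
  ultimately show ?thesis by (rule that)
qed

lemma degree_power_linear_le:
  assumes "degree g \<le> 1"
  shows "degree (g ^ n) \<le> n"
proof -
  have "degree g * n \<le> n"
    using mult_le_mono1[OF assms, of n] by simp
  with degree_power_le show ?thesis by (rule order_trans)
qed

lemma mult_as_sum_of_monoms:
  fixes p q :: "'a :: comm_semiring_1 poly"
  shows "p * q = (\<Sum>i\<le>degree p. smult (coeff p i) (monom 1 i * q))"
proof -
  have "p * q = (\<Sum>i\<le>degree p. monom (coeff p i) i) * q"
    by (simp only: poly_as_sum_of_monoms)
  then show ?thesis
    by (simp add: sum_distrib_right smult_monom flip: mult_smult_left)
qed

lemma RI_d_0 [simp]: "RI_d a l 0 = 1"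
  by (simp add: RI_d_def)

lemma RI_d_Suc: "RI_d a l (Suc m) = [:l (Suc m), a (Suc m):] * RI_d a l m"
  by (simp add: RI_d_def mult.commute)

lemma degree_RI_P_le: "degree (RI_P b a l n) \<le> n"
proof (induction b a l n rule: RI_P.induct)
  case (3 b a l n)
  have *: "degree ([:u, v:] * p) \<le> Suc k" if "degree p \<le> k" for u v :: complex and p k
    by (rule order_trans[OF degree_mult_le]) (use that in \<open>auto simp: degree_pCons_eq_if\<close>)
  show ?case
    unfolding RI_P.simps by (intro degree_diff_le le_SucI[OF *[OF 3(2)]] *[OF 3(1)])
qed auto

section \<open>Rational functions with denominator \<open>d m\<close>\<close>

locale RI_system =
  fixes b a l :: "nat \<Rightarrow> complex" and L :: "complex poly fract \<Rightarrow> complex"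
  assumes a_nonzero: "n \<ge> 1 \<Longrightarrow> a n \<noteq> 0"
    and P_root_nonzero: "n \<ge> 1 \<Longrightarrow> poly (RI_P b a l n) (- l n / a n) \<noteq> 0"
    and functional: "RI_functional b a l L"
begin

abbreviation P :: "nat \<Rightarrow> complex poly" where "P \<equiv> RI_P b a l"
abbreviation d :: "nat \<Rightarrow> complex poly" where "d \<equiv> RI_d a l"
abbreviation V :: "complex poly fract set" where "V \<equiv> RI_V b a l"
abbreviation root :: "nat \<Rightarrow> complex" where "root k \<equiv> - l k / a k"

text \<open>Separating numerator from denominator turns \<open>L\<close> into one linear form on
  polynomials for each \<open>m\<close>; \<open>W_linear_cancel\<close> links consecutive
  forms.\<close>

definition W :: "nat \<Rightarrow> complex poly \<Rightarrow> complex" where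
  "W m p = L (Fract p (d m))"

lemma a_Suc_nonzero: "a (Suc m) \<noteq> 0"
  by (rule a_nonzero) simp

lemma d_nonzero: "d m \<noteq> 0"
  using a_nonzero by (simp add: RI_d_def)

lemma Fract_add_d: "Fract (p + q) (d m) = Fract p (d m) + Fract q (d m)"
  using d_nonzero[of m] by (simp add: eq_fract algebra_simps)

lemma Fract_smult_d: "Fract (smult c p) (d m) = ratfun_scale c (Fract p (d m))"
  by (simp add: ratfun_scale_def)

lemma Fract_linear_cancel: "Fract ([:l (Suc m), a (Suc m):] * p) (d (Suc m)) = Fract p (d m)"
  using d_nonzero[of m] d_nonzero[of "Suc m"]
  by (simp add: eq_fract RI_d_Suc algebra_simps del: mult_pCons_left mult_pCons_right)

lemma Fract_sum_d:
  "finite I \<Longrightarrow> Fract (\<Sum>i\<in>I. f i) (d m) = (\<Sum>i\<in>I. Fract (f i) (d m))"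
  by (induction I rule: finite_induct)
     (simp_all add: Fract_add_d d_nonzero eq_fract Zero_fract_def)

lemma Fract_mult_P_in_V: "Fract (p * P m) (d m) \<in> V"
proof -
  have gen: "Fract (monom 1 i * P m) (d m) \<in> V" for i
    unfolding RI_V_def by (rule ratfun.span_base) (auto simp: RI_Q_def)
  have "p * P m = (\<Sum>i\<le>degree p. smult (coeff p i) (monom 1 i * P m))"
    by (rule mult_as_sum_of_monoms)
  then have "Fract (p * P m) (d m)
      = (\<Sum>i\<le>degree p. ratfun_scale (coeff p i) (Fract (monom 1 i * P m) (d m)))"
    by (simp add: Fract_sum_d Fract_smult_d)
  also have "\<dots> \<in> V"
    using gen unfolding RI_V_def by (intro ratfun.span_sum ratfun.span_scale)
  finally show ?thesis .
qed

text \<open>Linearity of \<open>L\<close> is known only on \<open>V\<close>, so the linearity of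
  \<open>W\<close> rests on this. Subtracting the multiple of \<open>P (Suc m)\<close> that agrees
  with \<open>p\<close> at \<open>root (Suc m)\<close> leaves a multiple of the linear factor, which
  cancels and lowers \<open>m\<close>.\<close>

lemma Fract_in_V: "Fract p (d m) \<in> V"
proof (induction m arbitrary: p)
  case 0
  then show ?case using Fract_mult_P_in_V[of p 0] by simp
next
  case (Suc m)
  define c where "c = poly p (root (Suc m)) / poly (P (Suc m)) (root (Suc m))"
  have "poly (p - smult c (P (Suc m))) (root (Suc m)) = 0"
    using P_root_nonzero[of "Suc m"] by (simp add: c_def)
  then obtain q where "p - smult c (P (Suc m)) = [:l (Suc m), a (Suc m):] * q"
    using linear_factor_dvd[OF a_Suc_nonzero _ le_SucI[OF order_refl]] by blast
  then have "p = [:c:] * P (Suc m) + [:l (Suc m), a (Suc m):] * q"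
    by (simp add: algebra_simps)
  then have "Fract p (d (Suc m)) = Fract ([:c:] * P (Suc m)) (d (Suc m)) + Fract q (d m)"
    by (simp only: Fract_add_d Fract_linear_cancel)
  also have "\<dots> \<in> V"
    using Fract_mult_P_in_V Suc.IH unfolding RI_V_def by (rule ratfun.span_add)
  finally show ?case .
qed

section \<open>Linearity and orthogonality of the functional\<close>

lemma W_add: "W m (p + q) = W m p + W m q"
  using functional Fract_in_V by (auto simp: W_def RI_functional_def Fract_add_d)

lemma W_smult: "W m (smult c p) = c * W m p"
  using functional Fract_in_V by (auto simp: W_def RI_functional_def Fract_smult_d)

lemma W_sum: "finite I \<Longrightarrow> W m (\<Sum>i\<in>I. f i) = (\<Sum>i\<in>I. W m (f i))"
  \<comment> \<open>The empty sum needs \<open>W m 0 = 0\<close>, which is homogeneity with scalar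
    \<open>0\<close>.\<close>
  by (induction I rule: finite_induct) (use W_smult[of m 0 0] in \<open>simp_all add: W_add\<close>)

lemma W_linear_cancel: "W (Suc m) ([:l (Suc m), a (Suc m):] * p) = W m p"
  by (simp only: W_def Fract_linear_cancel)

lemma W_monom_P: "i < m \<Longrightarrow> W m (monom 1 i * P m) = 0"
  using functional by (auto simp: W_def RI_functional_def RI_Q_def)

lemma W_mult_P:
  assumes "degree p < m"
  shows "W m (p * P m) = 0"
proof -
  have "p * P m = (\<Sum>i\<le>degree p. smult (coeff p i) (monom 1 i * P m))"
    by (rule mult_as_sum_of_monoms)
  then show ?thesis
    using assms by (simp add: W_sum W_smult W_monom_P)
qed

lemma W_monom_P_same: "W n (monom 1 n * P n) = 1"
proof (induction n)
  case 0
  then show ?case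
    using functional by (simp add: W_def RI_functional_def monom_0 pCons_one One_fract_def)
next
  case (Suc n)
  let ?e = "\<lambda>k. [:l k, a k:]"
  have "degree (monom 1 n * ?e (Suc (Suc n))) \<le> n + 1"
    by (rule order_trans[OF degree_mult_le]) (simp add: degree_monom_eq degree_pCons_eq_if)
  \<comment> \<open>Orthogonality is used one index higher, against a multiplier containing the
    factor \<open>?e (Suc (Suc n))\<close>; cancelling that factor returns to index
    \<open>Suc n\<close>.\<close>
  then have "0 = W (Suc (Suc n)) ((monom 1 n * ?e (Suc (Suc n))) * P (Suc (Suc n)))"
    by (subst W_mult_P) auto
  also have "\<dots> = W (Suc (Suc n)) (?e (Suc (Suc n)) * (monom 1 n * P (Suc (Suc n))))"
    by (simp only: ac_simps)
  also have "\<dots> = W (Suc n) (monom 1 n * P (Suc (Suc n)))"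
    by (rule W_linear_cancel)
  \<comment> \<open>In the recurrence the \<open>b\<close> term vanishes by orthogonality, and the
    last term cancels down to index \<open>n\<close>, where the induction hypothesis gives
    \<open>1\<close>.\<close>
  also have "monom 1 n * P (Suc (Suc n)) = monom 1 (Suc n) * P (Suc n)
      + smult (- b (Suc n)) (monom 1 n * P (Suc n)) + smult (- 1) (?e (Suc n) * (monom 1 n * P n))"
    by (simp add: monom_Suc algebra_simps)
  also have "W (Suc n) \<dots> = W (Suc n) (monom 1 (Suc n) * P (Suc n)) - 1"
    by (simp only: W_add W_smult W_linear_cancel W_monom_P Suc.IH) simp
  finally show ?case by simp
qed

section \<open>Column expansions and evaluation of the determinants\<close>

text \<open>The coefficients \<open>t\<close> do not depend on \<open>p\<close>, so a single column
  combination serves every row \<open>p = monom 1 i\<close>. They arise by repeatedly matching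
  values at \<open>root m\<close> and dividing out the linear factor.\<close>

lemma W_expansion:
  assumes g: "degree g \<le> 1" "\<And>k. 1 \<le> k \<Longrightarrow> k \<le> m \<Longrightarrow> poly g (root k) \<noteq> 0"
    and "degree s \<le> m"
  shows "\<exists>t. \<forall>p. W m (p * s) = (\<Sum>j<Suc m. t j * W j (p * g ^ j))"
  using g(2) assms(3)
proof (induction m arbitrary: s)
  case 0
  then obtain c where "s = [:c:]"
    by (auto elim: degree_eq_zeroE)
  then show ?case
    by (intro exI[of _ "\<lambda>_. c"]) (simp add: W_smult)
next
  case (Suc m)
  define c where "c = poly s (root (Suc m)) / poly g (root (Suc m)) ^ Suc m"
  have "degree (g ^ Suc m) \<le> Suc m"
    using g(1) by (rule degree_power_linear_le)
  then have deg: "degree (s - smult c (g ^ Suc m)) \<le> Suc m"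
    using Suc.prems(2) by (intro degree_diff_le order_trans[OF degree_smult_le])
  have "poly (s - smult c (g ^ Suc m)) (root (Suc m)) = 0"
    using Suc.prems(1)[of "Suc m"] by (simp add: c_def)
  then obtain q where q: "s - smult c (g ^ Suc m) = [:l (Suc m), a (Suc m):] * q" "degree q \<le> m"
    using linear_factor_dvd[OF a_Suc_nonzero _ deg] by blast
  obtain t where t: "\<And>p. W m (p * q) = (\<Sum>j<Suc m. t j * W j (p * g ^ j))"
    using Suc.IH[of q] Suc.prems(1) q(2) by auto
  have "W (Suc m) (p * s) = (\<Sum>j<Suc (Suc m). (t(Suc m := c)) j * W j (p * g ^ j))" for p
  proof -
    have "s = smult c (g ^ Suc m) + [:l (Suc m), a (Suc m):] * q"
      using q(1) by (simp only: diff_eq_eq add.commute)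
    then have "p * s = smult c (p * g ^ Suc m) + [:l (Suc m), a (Suc m):] * (p * q)"
      by (simp only: distrib_left mult_smult_right mult.left_commute)
    then have "W (Suc m) (p * s) = c * W (Suc m) (p * g ^ Suc m) + W m (p * q)"
      by (simp only: W_add W_smult W_linear_cancel)
    also have "W m (p * q) = (\<Sum>j<Suc m. (t(Suc m := c)) j * W j (p * g ^ j))"
      unfolding t by (intro sum.cong) auto
    finally show ?thesis by (subst sum.lessThan_Suc) simp
  qed
  then show ?case by blast
qed

text \<open>Nonvanishing of \<open>g\<close> is asked up to index \<open>n\<close> only:
  \<open>q\<close> is expanded in columns \<open>0\<close> to \<open>n\<close>, while at index
  \<open>Suc n\<close> the division is by the value of \<open>P (Suc n)\<close>.\<close>

lemma det_W_powers_Suc: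
  assumes g: "degree g \<le> 1" "\<And>k. 1 \<le> k \<Longrightarrow> k \<le> n \<Longrightarrow> poly g (root k) \<noteq> 0"
  defines "A \<equiv> \<lambda>i j. W j (monom 1 i * g ^ j)"
  shows "det (mat (Suc (Suc n)) (Suc (Suc n)) (\<lambda>(i, j). A i j)) =
    poly g (root (Suc n)) ^ Suc n / poly (P (Suc n)) (root (Suc n)) *
    det (mat (Suc n) (Suc n) (\<lambda>(i, j). A i j))"
proof -
  define c where "c = poly g (root (Suc n)) ^ Suc n / poly (P (Suc n)) (root (Suc n))"
  have "degree (g ^ Suc n) \<le> Suc n"
    using g(1) by (rule degree_power_linear_le)
  then have deg: "degree (g ^ Suc n - smult c (P (Suc n))) \<le> Suc n"
    by (intro degree_diff_le order_trans[OF degree_smult_le degree_RI_P_le])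
  have "poly (g ^ Suc n - smult c (P (Suc n))) (root (Suc n)) = 0"
    using P_root_nonzero[of "Suc n"] by (simp add: c_def)
  then obtain q where q: "g ^ Suc n - smult c (P (Suc n)) = [:l (Suc n), a (Suc n):] * q" "degree q \<le> n"
    using linear_factor_dvd[OF a_Suc_nonzero _ deg] by blast
  obtain t where t: "\<And>p. W n (p * q) = (\<Sum>j<Suc n. t j * W j (p * g ^ j))"
    using W_expansion[OF g q(2)] by auto
  have "A i (Suc n) = (if i = Suc n then c else 0) + (\<Sum>j<Suc n. t j * A i j)" if "i \<le> Suc n" for i
  proof -
    have "g ^ Suc n = smult c (P (Suc n)) + [:l (Suc n), a (Suc n):] * q"
      using q(1) by (simp only: diff_eq_eq add.commute)
    then have "monom 1 i * g ^ Suc n =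
        smult c (monom 1 i * P (Suc n)) + [:l (Suc n), a (Suc n):] * (monom 1 i * q)"
      by (simp only: distrib_left mult_smult_right mult.left_commute)
    then have "A i (Suc n) = c * W (Suc n) (monom 1 i * P (Suc n)) + W n (monom 1 i * q)"
      by (simp only: A_def W_add W_smult W_linear_cancel)
    also have "W (Suc n) (monom 1 i * P (Suc n)) = (if i = Suc n then 1 else 0)"
      using that W_monom_P[of i "Suc n"] W_monom_P_same by auto
    finally show ?thesis by (simp add: t A_def)
  qed
  then show ?thesis
    unfolding c_def[symmetric] by (rule det_last_column_combination)
qed

theorem det_W_powers:
  assumes g: "degree g \<le> 1"
  shows "det (mat (Suc n) (Suc n) (\<lambda>(i, j). W j (monom 1 i * g ^ j))) =
    (\<Prod>k = 1..n. poly g (root k) ^ k / poly (P k) (root k))"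
proof (cases "\<exists>k\<in>{1..n}. poly g (root k) = 0")
  case True
  then obtain k where k: "Suc k \<le> n" "poly g (root (Suc k)) = 0"
    by (metis atLeastAtMost_iff not0_implies_Suc not_one_le_zero)
  obtain q where q: "g = [:l (Suc k), a (Suc k):] * q" "degree q \<le> 0"
    using linear_factor_dvd[OF a_Suc_nonzero k(2), of 0] g by auto
  then obtain c where c: "q = [:c:]" by (auto elim: degree_eq_zeroE)
  \<comment> \<open>Having degree at most one and sharing the root, \<open>g\<close> is
    \<open>c\<close> times the linear factor, so one power of \<open>g\<close> cancels against the
    denominator.\<close>
  have "W (Suc k) (p * g ^ Suc k) = c * W k (p * g ^ k)" for p
  proof -
    have "p * g ^ Suc k = g * (p * g ^ k)"
      by (simp only: power_Suc mult.left_commute)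
    also have "\<dots> = [:l (Suc k), a (Suc k):] * (q * (p * g ^ k))"
      by (simp only: q(1) mult.assoc)
    also have "q * (p * g ^ k) = smult c (p * g ^ k)"
      by (simp add: c)
    finally show ?thesis by (simp only: W_linear_cancel W_smult)
  qed
  then have "det (mat (Suc n) (Suc n) (\<lambda>(i, j). W j (monom 1 i * g ^ j))) = 0"
    using k by (intro det_proportional_columns[of _ "Suc n" k "Suc k" c]) auto
  moreover have "(\<Prod>k = 1..n. poly g (root k) ^ k / poly (P k) (root k)) = 0"
    \<comment> \<open>The exponent \<open>Suc k\<close> is positive, so the factor at this index is
      \<open>0\<close>.\<close>
    using k by (intro prod_zero bexI[of _ "Suc k"]) auto
  ultimately show ?thesis by simp
next
  case False
  then show ?thesis
  proof (induction n)
    case 0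
    then show ?case
      using W_monom_P_same[of 0] by (simp add: det_single)
  next
    case (Suc n)
    have "det (mat (Suc (Suc n)) (Suc (Suc n)) (\<lambda>(i, j). W j (monom 1 i * g ^ j))) =
      poly g (root (Suc n)) ^ Suc n / poly (P (Suc n)) (root (Suc n)) *
      det (mat (Suc n) (Suc n) (\<lambda>(i, j). W j (monom 1 i * g ^ j)))"
      using Suc.prems by (intro det_W_powers_Suc[OF g]) auto
    with Suc show ?case by (simp add: mult.commute)
  qed
qed

end

theorem theorem6p7:
  fixes b a l :: "nat \<Rightarrow> complex" and L :: "complex poly fract \<Rightarrow> complex"
  assumes "\<And>n. n \<ge> 1 \<Longrightarrow> a n \<noteq> 0"
    and "\<And>n. n \<ge> 1 \<Longrightarrow> poly (RI_P b a l n) (- l n / a n) \<noteq> 0"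
    and "RI_functional b a l L"
    and "\<And>n. det (mat (n + 1) (n + 1) (\<lambda>(i, j). RI_moment a l L (i + j) n)) \<noteq> 0"
  shows "\<forall>n.
      det (mat (n + 1) (n + 1) (\<lambda>(i, j). RI_moment a l L (i + j) j)) =
        (\<Prod>k = 1..n. l k ^ k / ((- a k) ^ k * poly (RI_P b a l k) (- l k / a k))) \<and>
      det (mat (n + 1) (n + 1) (\<lambda>(i, j). RI_moment a l L i j)) =
        (\<Prod>k = 1..n. 1 / poly (RI_P b a l k) (- l k / a k))"
proof (intro allI conjI)
  interpret RI_system b a l L
    by unfold_locales (use assms in auto)
  fix n
  \<comment> \<open>For \<open>g = x\<close> the numerators are powers of \<open>root k\<close>; the
    sign is moved to \<open>a k\<close> to match the claimed form.\<close>
  have "(- l k / a k) ^ k = l k ^ k / (- a k) ^ k" for k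
    by (metis minus_divide_left minus_divide_right power_divide)
  then show "det (mat (n + 1) (n + 1) (\<lambda>(i, j). RI_moment a l L (i + j) j)) =
      (\<Prod>k = 1..n. l k ^ k / ((- a k) ^ k * poly (RI_P b a l k) (- l k / a k)))"
    using det_W_powers[of "monom 1 1" n]
    by (simp add: W_def RI_moment_def monom_power mult_monom poly_monom degree_monom_eq)
  show "det (mat (n + 1) (n + 1) (\<lambda>(i, j). RI_moment a l L i j)) =
      (\<Prod>k = 1..n. 1 / poly (RI_P b a l k) (- l k / a k))"
    using det_W_powers[of 1 n] by (simp add: W_def RI_moment_def)
qed

end
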